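(* $p(Q_4 \setminus e) = 6$.
   Context: For $n\ge 1$, $Q_n$ is the $n$-dimensional hypercube: the graph with vertex set $\{0,1\}^n$ and edges between vertices differing in exactly one coordinate. $Q_4\setminus e$ denotes the graph obtained from $Q_4$ by deleting one edge; by symmetry it does not depend, up to isomorphism, on the choice. An embedding of a graph $G$ in $Q_n$ is any subgraph of $Q_n$ isomorphic to $G$. Given a set of $r$ colors, a $G$-polychromatic $r$-coloring of $Q_n$ is an assignment of one of the $r$ colors to each edge of $Q_n$ such that every embedding of $G$ in $Q_n$ contains an edge of every one of the $r$ colors. The polychromatic number $p(G)$ is the largest integer $r$ such that for every $n$ for which $Q_n$ contains an embedding of $G$, there is a $G$-polychromatic $r$-coloring of $Q_n$. *)

theory Defs
  imports Main
begin

text \<open>Undirected simple graphs; an edge is the set of its two endpoints.\<close>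

datatype 'a graph = Graph (verts: "'a set") (edges: "'a set set")

definition subgraph :: "'a graph \<Rightarrow> 'a graph \<Rightarrow> bool" where
  "subgraph H G \<longleftrightarrow>
     verts H \<subseteq> verts G \<and> edges H \<subseteq> edges G \<and> (\<forall>e\<in>edges H. e \<subseteq> verts H)"

definition isomorphic :: "'a graph \<Rightarrow> 'b graph \<Rightarrow> bool" where
  "isomorphic G H \<longleftrightarrow>
     (\<exists>f. bij_betw f (verts G) (verts H) \<and>
          (\<forall>x\<in>verts G. \<forall>y\<in>verts G. {x, y} \<in> edges G \<longleftrightarrow> {f x, f y} \<in> edges H))"

definition delete_edge :: "'a graph \<Rightarrow> 'a set \<Rightarrow> 'a graph" where
  "delete_edge G e = Graph (verts G) (edges G - {e})"

text \<open>The vertex set \<open>{0,1}^n\<close> consists of the Boolean lists of length \<open>n\<close>.\<close>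

definition hypercube :: "nat \<Rightarrow> bool list graph" where
  "hypercube n = Graph {x. length x = n}
     {{x, y} | x y. length x = n \<and> length y = n \<and> card {i. i < n \<and> x ! i \<noteq> y ! i} = 1}"

definition embedding :: "'a graph \<Rightarrow> nat \<Rightarrow> bool list graph \<Rightarrow> bool" where
  "embedding G n H \<longleftrightarrow> subgraph H (hypercube n) \<and> isomorphic G H"

text \<open>The \<open>r\<close> colors are \<open>0, \<dots>, r - 1\<close>; values of \<open>c\<close> outside \<open>edges (hypercube n)\<close> are
  irrelevant.\<close>

definition polychromatic_coloring ::
    "'a graph \<Rightarrow> nat \<Rightarrow> nat \<Rightarrow> (bool list set \<Rightarrow> nat) \<Rightarrow> bool" where
  "polychromatic_coloring G r n c \<longleftrightarrow>
     (\<forall>e\<in>edges (hypercube n). c e < r) \<and>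
     (\<forall>H. embedding G n H \<longrightarrow> (\<forall>k<r. \<exists>e\<in>edges H. c e = k))"

definition polychromatic_number :: "'a graph \<Rightarrow> nat" where
  "polychromatic_number G =
     (GREATEST r. \<forall>n\<ge>1. (\<exists>H. embedding G n H) \<longrightarrow> (\<exists>c. polychromatic_coloring G r n c))"

end

theory Submission
  imports Defs "HOL-Library.Ramsey"
begin

text \<open>An embedding of the punctured 4-cube is a 4-dimensional subcube minus one edge, since two
  vertices at distance 2 have only two common neighbors. So it suffices for the lower bound that
  every subcube contains each color in two different directions. Identify vertices with sets and
  let the color of the edge from \<open>X\<close> to \<open>X \<union> {a}\<close> depend only on \<open>s = |X|\<close> and
  \<open>l = |{j \<in> X. j < a}|\<close>: the coloring \<open>2 (s mod 3) + ((l + s div 3) mod 2)\<close> has this property.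

  Conversely, by Ramsey's theorem every coloring depends only on \<open>s\<close> and \<open>l\<close> on a large subcube.
  A 4-dimensional subcube whose bottom vertex has size \<open>S\<close> then meets four rectangles
  \<open>{(S + p + q, x\<^sub>i + p). p \<le> i, q \<le> 3 - i}\<close>, where \<open>x\<^sub>0 \<le> x\<^sub>1 \<le> x\<^sub>2 \<le> x\<^sub>3 \<le> S\<close> are arbitrary. Passing to
  nested intervals, every color is met by all translates of one of its rectangles, and counting
  cells on the levels \<open>S, \<dots>, S + 3\<close> with weights \<open>1, 2, 2, 1\<close> leaves room for 6 colors only.\<close>

section \<open>Vertices of the cube as subsets of \<open>{..<n}\<close>\<close>

definition bits :: "nat \<Rightarrow> nat set \<Rightarrow> bool list" where
  "bits n X = map (\<lambda>i. i \<in> X) [0..<n]"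

definition ones :: "bool list \<Rightarrow> nat set" where
  "ones x = {i. i < length x \<and> x ! i}"

text \<open>Inequality of truth values makes claims about toggled coordinates propositional; two
  vertices are adjacent iff this set is a singleton.\<close>

definition symdiff :: "'a set \<Rightarrow> 'a set \<Rightarrow> 'a set" where
  "symdiff A B = {x. (x \<in> A) \<noteq> (x \<in> B)}"

lemma in_symdiff [simp]: "x \<in> symdiff A B \<longleftrightarrow> (x \<in> A) \<noteq> (x \<in> B)"
  by (simp add: symdiff_def)

lemma symdiff_subset: "A \<subseteq> C \<Longrightarrow> B \<subseteq> C \<Longrightarrow> symdiff A B \<subseteq> C"
  by auto

lemma symdiff_singletonD:
  assumes "symdiff X Y = {a}"
  shows "a \<notin> X \<and> Y = insert a X \<or> a \<notin> Y \<and> X = insert a Y"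
proof -
  have *: "(x \<in> X) \<noteq> (x \<in> Y) \<longleftrightarrow> x = a" for x
    using assms by (metis in_symdiff singleton_iff)
  show ?thesis
  proof (cases "a \<in> X")
    case True
    then have "a \<notin> Y" "X = insert a Y" using * by (metis, metis insert_iff set_eqI *)
    then show ?thesis by simp
  next
    case False
    then have "Y = insert a X" using * by (metis insert_iff set_eqI)
    then show ?thesis using False by simp
  qed
qed

lemma symdiff_insert:
  assumes "x \<notin> S"
  shows "symdiff A (insert x S) = symdiff (symdiff A S) {x}"
  using assms by (intro set_eqI) (simp, metis)

lemma length_bits [simp]: "length (bits n X) = n"
  by (simp add: bits_def)

lemma nth_bits [simp]: "i < n \<Longrightarrow> bits n X ! i \<longleftrightarrow> i \<in> X"
  by (simp add: bits_def)

lemma ones_bits [simp]: "X \<subseteq> {..<n} \<Longrightarrow> ones (bits n X) = X"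
  by (auto simp: ones_def)

lemma bits_ones [simp]: "length x = n \<Longrightarrow> bits n (ones x) = x"
  by (auto intro!: nth_equalityI simp: ones_def)

lemma ones_subset: "length x = n \<Longrightarrow> ones x \<subseteq> {..<n}"
  by (auto simp: ones_def)

lemma bits_eq_iff: "X \<subseteq> {..<n} \<Longrightarrow> Y \<subseteq> {..<n} \<Longrightarrow> bits n X = bits n Y \<longleftrightarrow> X = Y"
  by (metis ones_bits)

lemma hypercube_edge_iff:
  assumes "X \<subseteq> {..<n}" "Y \<subseteq> {..<n}"
  shows "{bits n X, bits n Y} \<in> edges (hypercube n) \<longleftrightarrow> (\<exists>a. symdiff X Y = {a})"
proof -
  \<comment> \<open>Both orders occur, since an unordered edge does not tell which endpoint comes
    first.\<close>
  have diff: "{i. i < n \<and> bits n X ! i \<noteq> bits n Y ! i} = symdiff X Y"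
       "{i. i < n \<and> bits n Y ! i \<noteq> bits n X ! i} = symdiff X Y"
    using assms by (auto simp: symdiff_def)
  have "{bits n X, bits n Y} \<in> edges (hypercube n) \<longleftrightarrow> card (symdiff X Y) = 1"
  proof
    assume "{bits n X, bits n Y} \<in> edges (hypercube n)"
    then obtain x y where "{bits n X, bits n Y} = {x, y}"
       and c: "card {i. i < n \<and> x ! i \<noteq> y ! i} = 1"
      by (auto simp: hypercube_def)
    then have "x = bits n X \<and> y = bits n Y \<or> x = bits n Y \<and> y = bits n X"
      by (auto simp: doubleton_eq_iff)
    then show "card (symdiff X Y) = 1"
      by (elim disjE conjE) (use c diff in simp_all)
  next
    assume "card (symdiff X Y) = 1"
    with diff have "card {i. i < n \<and> bits n X ! i \<noteq> bits n Y ! i} = 1" by simp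
    then show "{bits n X, bits n Y} \<in> edges (hypercube n)"
      unfolding hypercube_def graph.sel mem_Collect_eq using length_bits by blast
  qed
  then show ?thesis by (simp add: card_1_singleton_iff)
qed

lemma hypercube_edgeE:
  assumes "e \<in> edges (hypercube n)"
  obtains X a where "X \<subseteq> {..<n}" "a < n" "a \<notin> X" "e = {bits n X, bits n (insert a X)}"
proof -
  obtain x y where e: "e = {x, y}" "length x = n" "length y = n"
    using assms by (auto simp: hypercube_def)
  have sub: "ones x \<subseteq> {..<n}" "ones y \<subseteq> {..<n}"
    using e ones_subset by blast+
  have e': "e = {bits n (ones x), bits n (ones y)}" using e by simp
  then obtain a where a: "symdiff (ones x) (ones y) = {a}"
    using assms hypercube_edge_iff sub by metis
  from symdiff_singletonD[OF this]
  consider "a \<notin> ones x" "ones y = insert a (ones x)" | "a \<notin> ones y" "ones x = insert a (ones y)"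
    by metis
  then show ?thesis
  proof cases
    case 1
    then show ?thesis using e' sub by (intro that[of "ones x" a]) auto
  next
    case 2
    then show ?thesis using e' sub by (intro that[of "ones y" a]) auto
  qed
qed

lemma hypercube_edgeI:
  assumes "X \<subseteq> {..<n}" "a < n" "a \<notin> X"
  shows "{bits n X, bits n (insert a X)} \<in> edges (hypercube n)"
proof -
  have "symdiff X (insert a X) = {a}" using assms by auto
  moreover have "insert a X \<subseteq> {..<n}" using assms by auto
  ultimately show ?thesis using hypercube_edge_iff assms by metis
qed

lemma verts_hypercube: "verts (hypercube n) = {x. length x = n}"
  by (simp add: hypercube_def)

subsection \<open>Embeddings of the punctured cube\<close>

text \<open>\<open>X\<close> arises from \<open>P\<close> by toggling \<open>a\<close> and
  \<open>u\<close>, and also by toggling \<open>b\<close> and \<open>v\<close>. As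
  \<open>a \<noteq> b\<close>, either \<open>u = b\<close>, or \<open>u = a\<close> and the two
  toggles cancel, giving \<open>X = P\<close>.\<close>

lemma square_corner:
  assumes "symdiff (symdiff P {a}) X = {u}" "symdiff (symdiff P {b}) X = {v}"
    and "a \<noteq> b" "X \<noteq> P"
  shows "X = symdiff P {a, b}"
proof -
  have X1: "x \<in> X \<longleftrightarrow> ((x \<in> P) \<noteq> (x = a)) \<noteq> (x = u)" for x
    using assms(1) by (metis in_symdiff singleton_iff)
  have X2: "x \<in> X \<longleftrightarrow> ((x \<in> P) \<noteq> (x = b)) \<noteq> (x = v)" for x
    using assms(2) by (metis in_symdiff singleton_iff)
  have "u = b"
  proof (rule ccontr)
    assume "u \<noteq> b"
    then have "u = a" using X1[of b] X2[of b] X1[of a] X2[of a] assms(3) by metis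
    then have "x \<in> X \<longleftrightarrow> x \<in> P" for x using X1[of x] by metis
    then show False using assms(4) by blast
  qed
  then have "x \<in> X \<longleftrightarrow> x \<in> symdiff P {a, b}" for x
    using X1[of x] assms(3) by (simp, metis)
  then show ?thesis by blast
qed

text \<open>Induction on \<open>card A\<close>: from size 2 on, \<open>F A\<close> is a common
  neighbor of \<open>F (A - {i})\<close> and \<open>F (A - {j})\<close>, hence the corner opposite
  to \<open>F (A - {i, j})\<close>. So \<open>F\<close> is a relabeling \<open>d\<close> of
  coordinates followed by a translation by \<open>F {}\<close>. The only adjacency not assumed is
  that of the full set with its subset lacking \<open>t\<close>.\<close>

lemma punctured_cube_rigid:
  fixes F :: "nat set \<Rightarrow> nat set"
  assumes inj: "inj_on F (Pow {..<4})"
    and adj: "\<And>A i. A \<subseteq> {..<4} \<Longrightarrow> i \<in> A \<Longrightarrow> A \<noteq> {..<4} \<or> i \<noteq> t \<Longrightarrow>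
      \<exists>a. symdiff (F (A - {i})) (F A) = {a}"
  obtains d where "inj_on d {..<4}" "\<And>A. A \<subseteq> {..<4} \<Longrightarrow> F A = symdiff (F {}) (d ` A)"
proof -
  have "\<exists>a. symdiff (F {}) (F {i}) = {a}" if "i < 4" for i
  proof -
    \<comment> \<open>Edges at the empty set are never the missing one, because a singleton is not
      the full set.\<close>
    have "{i} \<noteq> {..<4}"
      by (metis card_lessThan card.empty card_insert_disjoint empty_iff finite.emptyI
          numeral_eq_one_iff One_nat_def semiring_norm(85))
    then show ?thesis using adj[of "{i}" i] that by simp
  qed
  then obtain d where d: "\<And>i. i < 4 \<Longrightarrow> symdiff (F {}) (F {i}) = {d i}"
    by metis
  have F1: "F {i} = symdiff (F {}) {d i}" if "i < 4" for i
    using d[OF that] by (metis in_symdiff singleton_iff set_eqI)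
  have inj_d: "inj_on d {..<4}"
  proof (rule inj_onI)
    fix i j :: nat assume "i \<in> {..<4}" "j \<in> {..<4}" "d i = d j"
    then have "F {i} = F {j}" using F1 by simp
    with \<open>i \<in> {..<4}\<close> \<open>j \<in> {..<4}\<close> show "i = j"
      using inj_onD[OF inj, of "{i}" "{j}"] by simp
  qed
  have "F A = symdiff (F {}) (d ` A)" if "A \<subseteq> {..<4}" for A
    using that
  proof (induction "card A" arbitrary: A rule: less_induct)
    case less
    have fin: "finite A" using less.prems finite_subset by blast
    consider "card A = 0" | "card A = 1" | "card A \<ge> 2" by linarith
    then show ?case
    proof cases
      case 1
      then show ?thesis using fin by auto
    next
      case 2
      then obtain i where "A = {i}" by (auto simp: card_1_singleton_iff)
      then show ?thesis using F1[of i] less.prems by simp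
    next
      case 3
      \<comment> \<open>For the full set both directions must avoid \<open>t\<close>; at least three
        of its elements differ from \<open>t\<close>.\<close>
      have "\<exists>i j. i \<in> A \<and> j \<in> A \<and> i \<noteq> j \<and> (A \<noteq> {..<4} \<or> i \<noteq> t \<and> j \<noteq> t)"
      proof (cases "A = {..<4}")
        case True
        then have "card A - card {t} \<ge> 2" by simp
        then have "card (A - {t}) \<ge> 2"
          by (meson diff_card_le_card_Diff finite.emptyI finite.insertI le_trans)
        then obtain i j where "i \<in> A - {t}" "j \<in> A - {t}" "i \<noteq> j"
          by (metis card_2_iff' card_le_Suc0_iff_eq fin finite_Diff not_less_eq_eq numeral_2_eq_2)
        then show ?thesis by blast
      next
        case False
        then show ?thesis using 3 fin
          by (metis card_le_Suc0_iff_eq not_less_eq_eq numeral_2_eq_2)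
      qed
      then obtain i j where ij: "i \<in> A" "j \<in> A" "i \<noteq> j" "A \<noteq> {..<4} \<or> i \<noteq> t \<and> j \<noteq> t"
        by blast
      have dij: "d i \<noteq> d j" using ij less.prems inj_onD[OF inj_d] by blast
      have smaller: "card (A - W) < card A" if "k \<in> A" "k \<in> W" for k W
        using fin that by (intro psubset_card_mono) auto
      define P where "P = F (A - {i, j})"
      have P: "P = symdiff (F {}) (d ` (A - {i, j}))"
        unfolding P_def using ij fin less.prems
        by (intro less.hyps smaller[of i]) auto
      have im: "d ` A = insert (d i) (insert (d j) (d ` (A - {i, j})))"
        "d ` (A - {i}) = insert (d j) (d ` (A - {i, j}))"
        "d ` (A - {j}) = insert (d i) (d ` (A - {i, j}))" using ij by auto
      have notin: "d i \<notin> d ` (A - {i, j})" "d j \<notin> d ` (A - {i, j})"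
        using inj_on_image_mem_iff[OF inj_d, of i "A - {i, j}"]
          inj_on_image_mem_iff[OF inj_d, of j "A - {i, j}"] ij less.prems by blast+
      have "F (A - {i}) = symdiff (F {}) (d ` (A - {i}))"
        using ij fin less.prems by (intro less.hyps smaller[of i]) auto
      then have Fi: "F (A - {i}) = symdiff P {d j}"
        unfolding P im symdiff_insert[OF notin(2)] .
      have "F (A - {j}) = symdiff (F {}) (d ` (A - {j}))"
        using ij fin less.prems by (intro less.hyps smaller[of j]) auto
      then have Fj: "F (A - {j}) = symdiff P {d i}"
        unfolding P im symdiff_insert[OF notin(1)] .
      obtain u where u: "symdiff (F (A - {i})) (F A) = {u}" using adj ij less.prems by metis
      obtain v where v: "symdiff (F (A - {j})) (F A) = {v}" using adj ij less.prems by metis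
      \<comment> \<open>Injectivity rules out \<open>P\<close>, the other common neighbor.\<close>
      have "F A \<noteq> P"
        unfolding P_def using inj_onD[OF inj, of A "A - {i, j}"] ij less.prems by auto
      then have "F A = symdiff P {d j, d i}"
        using square_corner[OF u[unfolded Fi] v[unfolded Fj]] dij by metis
      also have "\<dots> = symdiff (symdiff P {d j}) {d i}"
        using symdiff_insert[of "d j" "{d i}" P] dij by (intro set_eqI) (simp, metis)
      also have "\<dots> = symdiff (F {}) (d ` A)"
        unfolding P im using notin dij
        by (subst symdiff_insert[of "d i"], simp) (subst symdiff_insert[of "d j"], simp_all)
      finally show ?thesis .
    qed
  qed
  with inj_d show ?thesis using that by blast
qed

text \<open>Rigidity makes the image a subcube with bottom vertex \<open>B\<close> and directions
  \<open>D\<close>. All edges of direction \<open>a\<^sub>0\<close> are given up although only one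
  of them is missing; this costs nothing for a coloring that shows each color in two
  directions.\<close>

lemma embedding_punctured_cubeE:
  assumes H: "embedding (delete_edge (hypercube 4) e) n H" and e: "e \<in> edges (hypercube 4)"
  obtains B D a\<^sub>0 where "B \<subseteq> {..<n}" "D \<subseteq> {..<n}" "card D = 4" "B \<inter> D = {}"
    "\<And>T a. T \<subseteq> D \<Longrightarrow> a \<in> D - T \<Longrightarrow> a \<noteq> a\<^sub>0 \<Longrightarrow>
      {bits n (B \<union> T), bits n (B \<union> insert a T)} \<in> edges H"
proof -
  let ?Q = "delete_edge (hypercube 4) e"
  have sub: "subgraph H (hypercube n)" using H by (simp add: embedding_def)
  obtain f where f: "bij_betw f (verts ?Q) (verts H)"
    and fe: "\<And>x y. x \<in> verts ?Q \<Longrightarrow> y \<in> verts ?Q \<Longrightarrow> {x, y} \<in> edges ?Q \<longleftrightarrow> {f x, f y} \<in> edges H"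
    using H by (auto simp: embedding_def isomorphic_def)
  have vQ: "verts ?Q = {x. length x = 4}" by (simp add: delete_edge_def verts_hypercube)
  have eQ: "edges ?Q = edges (hypercube 4) - {e}" by (simp add: delete_edge_def)
  have len: "length (f x) = n" if "length x = 4" for x
    using bij_betwE[OF f] sub that unfolding vQ by (auto simp: subgraph_def verts_hypercube)
  obtain X t where X: "X \<subseteq> {..<4}" "t < 4" "t \<notin> X" and eX: "e = {bits 4 X, bits 4 (insert t X)}"
    using hypercube_edgeE[OF e] by metis
  \<comment> \<open>Translating by \<open>U\<close> moves the deleted edge to the top vertex, away from the origin.\<close>
  define U where "U = {..<4} - insert t X"
  have U: "U \<subseteq> {..<4}" by (auto simp: U_def)
  define F where "F A = ones (f (bits 4 (symdiff A U)))" for A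
  have Fn: "F A \<subseteq> {..<n}" for A unfolding F_def by (intro ones_subset len) simp
  have bF: "bits n (F A) = f (bits 4 (symdiff A U))" for A
    unfolding F_def by (intro bits_ones len) simp
  have edge: "{bits n (F (A - {i})), bits n (F A)} \<in> edges H"
    if A: "A \<subseteq> {..<4}" "i \<in> A" and ne: "A \<noteq> {..<4} \<or> i \<noteq> t" for A i
  proof -
    have s: "symdiff (A - {i}) U \<subseteq> {..<4}" "symdiff A U \<subseteq> {..<4}"
      using A U by (intro symdiff_subset; blast)+
    have sd: "symdiff (symdiff (A - {i}) U) (symdiff A U) = {i}"
      using A(2) by (intro set_eqI) (simp, metis)
    then have 1: "{bits 4 (symdiff (A - {i}) U), bits 4 (symdiff A U)} \<in> edges (hypercube 4)"
      using hypercube_edge_iff[OF s] by blast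
    have 2: "{bits 4 (symdiff (A - {i}) U), bits 4 (symdiff A U)} \<noteq> e"
    proof
      assume "{bits 4 (symdiff (A - {i}) U), bits 4 (symdiff A U)} = e"
      then have "symdiff (A - {i}) U = X \<and> symdiff A U = insert t X \<or>
          symdiff (A - {i}) U = insert t X \<and> symdiff A U = X"
        unfolding eX doubleton_eq_iff using s X by (auto simp: bits_eq_iff)
      moreover have "symdiff X (insert t X) = {t}" "symdiff (insert t X) X = {t}"
        using X(3) by auto
      ultimately have it: "i = t" and "symdiff A U = insert t X \<or> symdiff A U = X"
        using sd by auto
      then show False
      proof (elim disjE)
        assume "symdiff A U = insert t X"
        then have "x \<in> A" if "x < 4" for x
          using that unfolding U_def by (metis DiffD2 DiffI in_symdiff lessThan_iff)
        then have "A = {..<4}" using A by auto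
        then show False using ne it by simp
      next
        assume "symdiff A U = X"
        then have "t \<notin> A" using X unfolding U_def by (metis DiffD2 in_symdiff insertI1)
        then show False using A it by simp
      qed
    qed
    show ?thesis unfolding bF using 1 2 by (subst fe[symmetric]) (auto simp: vQ eQ)
  qed
  have injF: "inj_on F (Pow {..<4})"
  proof (rule inj_onI)
    fix A A' assume A: "A \<in> Pow {..<4::nat}" "A' \<in> Pow {..<4::nat}" and "F A = F A'"
    then have "f (bits 4 (symdiff A U)) = f (bits 4 (symdiff A' U))" using bF by metis
    then have "bits 4 (symdiff A U) = bits 4 (symdiff A' U)"
      using bij_betw_imp_inj_on[OF f] by (auto simp: vQ inj_on_def)
    moreover have "symdiff A U \<subseteq> {..<4}" "symdiff A' U \<subseteq> {..<4}"
      using A U by (auto intro!: symdiff_subset)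
    ultimately have "symdiff A U = symdiff A' U" by (simp add: bits_eq_iff)
    then show "A = A'" by (metis in_symdiff set_eqI)
  qed
  have adjF: "\<exists>a. symdiff (F (A - {i})) (F A) = {a}"
    if "A \<subseteq> {..<4}" "i \<in> A" "A \<noteq> {..<4} \<or> i \<noteq> t" for A i
  proof -
    have "{bits n (F (A - {i})), bits n (F A)} \<in> edges (hypercube n)"
      using edge[OF that] sub by (auto simp: subgraph_def)
    then show ?thesis using hypercube_edge_iff[OF Fn Fn] by blast
  qed
  obtain d where d: "inj_on d {..<4}" and Fd: "\<And>A. A \<subseteq> {..<4} \<Longrightarrow> F A = symdiff (F {}) (d ` A)"
    using punctured_cube_rigid[OF injF, of t] adjF by metis
  define D where "D = d ` {..<4}"
  \<comment> \<open>\<open>F {}\<close> may be any corner of the subcube; clearing the coordinates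
    in \<open>D\<close> gives its bottom vertex.\<close>
  define B where "B = F {} - D"
  have "D \<subseteq> {..<n}"
  proof
    fix x assume "x \<in> D"
    then have "x \<in> F {..<4} \<or> x \<in> F {}"
      using Fd[of "{..<4}"] unfolding D_def by (metis in_symdiff order_refl)
    then show "x \<in> {..<n}" using Fn by blast
  qed
  moreover have "card D = 4" using d by (simp add: D_def card_image)
  moreover have "B \<subseteq> {..<n}" "B \<inter> D = {}" using Fn[of "{}"] by (auto simp: B_def)
  moreover have "{bits n (B \<union> T), bits n (B \<union> insert a T)} \<in> edges H"
    if T: "T \<subseteq> D" and a: "a \<in> D - T" and ne: "a \<noteq> d t" for T a
  proof -
    \<comment> \<open>\<open>idx W\<close> solves \<open>F A = B \<union> W\<close> for
      \<open>A\<close>: the directions in which \<open>W\<close> differs from the corner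
      \<open>F {}\<close>, pulled back along \<open>d\<close>.\<close>
    define idx where "idx W = {i. i < 4 \<and> d i \<in> symdiff W (F {} \<inter> D)}" for W
    have idx: "idx W \<subseteq> {..<4}" for W by (auto simp: idx_def)
    have Fidx: "F (idx W) = B \<union> W" if "W \<subseteq> D" for W
    proof -
      have "symdiff W (F {} \<inter> D) \<subseteq> d ` {..<4}"
        using that unfolding D_def by (intro symdiff_subset) auto
      then have "d ` idx W = symdiff W (F {} \<inter> D)" by (auto simp: idx_def simp del: in_symdiff)
      then have "F (idx W) = symdiff (F {}) (symdiff W (F {} \<inter> D))" using Fd[OF idx] by metis
      also have "\<dots> = B \<union> W" using that unfolding B_def by (intro set_eqI) (simp, blast)
      finally show ?thesis .
    qed
    have aT: "insert a T \<subseteq> D" using a T by blast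
    obtain i where i: "i < 4" "a = d i" using a by (auto simp: D_def)
    then have it: "i \<noteq> t" using ne by blast
    have same: "j \<in> idx (insert a T) \<longleftrightarrow> j \<in> idx T" if "j \<noteq> i" for j
      using that i inj_onD[OF d, of i j] by (auto simp: idx_def)
    have flip: "i \<in> idx (insert a T) \<longleftrightarrow> i \<notin> idx T"
      using i a by (auto simp: idx_def)
    show ?thesis
    \<comment> \<open>Adding \<open>a\<close> to \<open>T\<close> removes \<open>i\<close> from the
      index set if \<open>a\<close> lies in \<open>F {}\<close> and inserts it otherwise. Since
      \<open>i \<noteq> t\<close>, the edge is present either way.\<close>
    proof (cases "i \<in> idx T")
      case True
      then have "idx (insert a T) = idx T - {i}"
        using same flip by (intro set_eqI) (metis Diff_iff singleton_iff)
      then have "{bits n (F (idx (insert a T))), bits n (F (idx T))} \<in> edges H"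
        using edge[OF idx[of T] True] it by simp
      then show ?thesis using Fidx[OF T] Fidx[OF aT] by (simp add: insert_commute)
    next
      case False
      then have *: "idx T = idx (insert a T) - {i}" "i \<in> idx (insert a T)"
        using same flip by (intro set_eqI, metis Diff_iff singleton_iff) (simp add: flip False)
      then have "{bits n (F (idx T)), bits n (F (idx (insert a T)))} \<in> edges H"
        using edge[OF idx[of "insert a T"] *(2)] it by simp
      then show ?thesis using Fidx[OF T] Fidx[OF aT] by simp
    qed
  qed
  ultimately show ?thesis using that by blast
qed

text \<open>Serves the upper bound, where an inclusion of edges is enough: a color found on the copy
  also occurs on the subcube.\<close>

lemma embedding_punctured_cubeI:
  assumes e: "e \<in> edges (hypercube 4)" and "B \<subseteq> {..<n}" "D \<subseteq> {..<n}" "card D = 4" "B \<inter> D = {}"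
  obtains H where "embedding (delete_edge (hypercube 4) e) n H"
    "edges H \<subseteq> {{bits n (B \<union> T), bits n (B \<union> insert a T)} | T a. T \<subseteq> D \<and> a \<in> D - T}"
proof -
  let ?Q = "delete_edge (hypercube 4) e"
  have vQ: "verts ?Q = {x. length x = 4}" by (simp add: delete_edge_def verts_hypercube)
  have eQ: "edges ?Q = edges (hypercube 4) - {e}" by (simp add: delete_edge_def)
  have "finite D" using assms(4) card.infinite by fastforce
  then obtain d :: "nat \<Rightarrow> nat" where d: "bij_betw d {..<4} D"
    using ex_bij_betw_nat_finite assms(4) by (metis atLeast0LessThan)
  define f where "f x = bits n (B \<union> d ` ones x)" for x
  have dD: "d ` ones x \<subseteq> D" if "length x = 4" for x
    using d ones_subset[OF that] by (auto simp: bij_betw_def)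
  have inj: "inj_on f (verts ?Q)"
  proof (rule inj_onI)
    fix x y assume xy: "x \<in> verts ?Q" "y \<in> verts ?Q" "f x = f y"
    then have len: "length x = 4" "length y = 4" by (auto simp: vQ)
    have "B \<union> d ` ones x = B \<union> d ` ones y"
      using xy(3) dD[OF len(1)] dD[OF len(2)] assms unfolding f_def by (subst (asm) bits_eq_iff) auto
    then have "d ` ones x = d ` ones y" using dD[OF len(1)] dD[OF len(2)] assms(5) by blast
    then have "ones x = ones y"
      using d len ones_subset by (metis bij_betw_def inj_on_image_eq_iff)
    then show "x = y" using len bits_ones by metis
  qed
  define H where "H = Graph (f ` verts ?Q) ((`) f ` edges ?Q)"
  have eV: "w \<subseteq> verts ?Q" if "w \<in> edges ?Q" for w
    using that unfolding eQ vQ by (auto simp: hypercube_def)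
  have edges: "\<exists>T a. f ` w = {bits n (B \<union> T), bits n (B \<union> insert a T)} \<and> T \<subseteq> D \<and> a \<in> D - T"
    if w: "w \<in> edges ?Q" for w
  proof -
    obtain X i where X: "X \<subseteq> {..<4}" "i < 4" "i \<notin> X" "w = {bits 4 X, bits 4 (insert i X)}"
      using hypercube_edgeE w eQ by (metis DiffD1)
    then have "f ` w = {bits n (B \<union> d ` X), bits n (B \<union> insert (d i) (d ` X))}"
      by (simp add: f_def)
    moreover have "d ` X \<subseteq> D" "d i \<in> D" using d X by (auto simp: bij_betw_def)
    moreover have "d i \<notin> d ` X" using d X by (auto simp: bij_betw_def inj_on_def)
    ultimately show ?thesis by blast
  qed
  have Hn: "edges H \<subseteq> edges (hypercube n)"
  proof
    fix w assume "w \<in> edges H"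
    then obtain w' where "w' \<in> edges ?Q" "w = f ` w'" by (auto simp: H_def)
    then obtain T a where T: "w = {bits n (B \<union> T), bits n (B \<union> insert a T)}" "T \<subseteq> D" "a \<in> D - T"
      using edges by metis
    then show "w \<in> edges (hypercube n)"
      using hypercube_edgeI[of "B \<union> T" n a] assms by auto
  qed
  have "subgraph H (hypercube n)"
    unfolding subgraph_def using Hn eV by (auto simp: H_def verts_hypercube f_def)
  moreover have "isomorphic ?Q H"
    unfolding isomorphic_def
  proof (intro exI conjI ballI)
    show "bij_betw f (verts ?Q) (verts H)" using inj by (simp add: H_def bij_betw_def)
    fix x y assume xy: "x \<in> verts ?Q" "y \<in> verts ?Q"
    show "{x, y} \<in> edges ?Q \<longleftrightarrow> {f x, f y} \<in> edges H"
    proof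
      assume "{x, y} \<in> edges ?Q"
      then have "f ` {x, y} \<in> edges H" unfolding H_def graph.sel by (rule imageI)
      then show "{f x, f y} \<in> edges H" by simp
    next
      assume "{f x, f y} \<in> edges H"
      then obtain w where w: "w \<in> edges ?Q" "f ` w = f ` {x, y}" by (auto simp: H_def)
      then have "w = {x, y}"
        using inj_on_image_eq_iff[OF inj eV[OF w(1)], of "{x, y}"] xy by blast
      then show "{x, y} \<in> edges ?Q" using w by simp
    qed
  qed
  moreover have "edges H \<subseteq> {{bits n (B \<union> T), bits n (B \<union> insert a T)} | T a. T \<subseteq> D \<and> a \<in> D - T}"
    using edges by (auto simp: H_def)
  ultimately show ?thesis using that by (auto simp: embedding_def)
qed

subsection \<open>Simple colorings\<close>

definition rank :: "nat \<Rightarrow> nat set \<Rightarrow> nat" where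
  "rank a X = card {j \<in> X. j < a}"

lemma rank_empty [simp]: "rank a {} = 0"
  by (simp add: rank_def)

lemma rank_Un_disjoint:
  assumes "finite X" "finite Y" "X \<inter> Y = {}"
  shows "rank a (X \<union> Y) = rank a X + rank a Y"
proof -
  have "{j \<in> X \<union> Y. j < a} = {j \<in> X. j < a} \<union> {j \<in> Y. j < a}" by auto
  then show ?thesis unfolding rank_def using assms by (simp add: card_Un_disjoint disjoint_iff)
qed

lemma rank_insert:
  assumes "finite X" "x \<notin> X"
  shows "rank a (insert x X) = (if x < a then 1 else 0) + rank a X"
proof -
  have "{j. j = x \<and> j < a} = (if x < a then {x} else {})" by auto
  then show ?thesis using rank_Un_disjoint[of "{x}" X a] assms by (auto simp: rank_def)
qed

lemma rank_inj:
  assumes "finite X" "a \<in> X" "b \<in> X" "rank a X = rank b X"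
  shows "a = b"
proof -
  have less: "rank u X < rank v X" if "u \<in> X" "u < v" for u v
    unfolding rank_def using assms(1) that by (intro psubset_card_mono) auto
  show ?thesis using less[of a b] less[of b a] assms by linarith
qed

lemma rank_image:
  assumes "strict_mono_on M h" "X \<subseteq> M" "a \<in> M"
  shows "rank (h a) (h ` X) = rank a X"
proof -
  have "h j < h a \<longleftrightarrow> j < a" if "j \<in> X" for j
    using strict_mono_on_less[OF assms(1)] that assms by blast
  then have "{j \<in> h ` X. j < h a} = h ` {j \<in> X. j < a}" by auto
  moreover have "inj_on h {j \<in> X. j < a}"
    using strict_mono_on_imp_inj_on[OF assms(1)] assms(2) by (auto intro: inj_on_subset)
  ultimately show ?thesis by (simp add: rank_def card_image)
qed

text \<open>For an edge \<open>w = {X, insert a X}\<close> of the subset lattice, \<open>\<Inter>w = X\<close> and \<open>\<Union>w - \<Inter>w = {a}\<close>.\<close>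

definition simple_coloring :: "(nat \<Rightarrow> nat \<Rightarrow> nat) \<Rightarrow> bool list set \<Rightarrow> nat" where
  "simple_coloring g w = (let X = \<Inter>(ones ` w) in g (card X) (rank (the_elem (\<Union>(ones ` w) - X)) X))"

lemma simple_coloring_edge:
  assumes "X \<subseteq> {..<n}" "a < n" "a \<notin> X"
  shows "simple_coloring g {bits n X, bits n (insert a X)} = g (card X) (rank a X)"
proof -
  have "X \<inter> insert a X = X" "X \<union> insert a X - X = {a}" using assms by auto
  moreover have "insert a X \<subseteq> {..<n}" using assms by auto
  ultimately show ?thesis using assms by (simp add: simple_coloring_def)
qed

text \<open>Edges of the same level \<open>s\<close> receive only two of the six colors, alternating along the level;
  the phase of the alternation changes whenever \<open>s\<close> increases by 3.\<close>

definition six_coloring :: "nat \<Rightarrow> nat \<Rightarrow> nat" where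
  "six_coloring s l = 2 * (s mod 3) + (l + s div 3) mod 2"

lemma six_coloring_less: "six_coloring s l < 6"
proof -
  have "s mod 3 < 3" "(l + s div 3) mod 2 < 2" by simp_all
  then show ?thesis unfolding six_coloring_def by linarith
qed

lemma six_coloring_eqI:
  assumes "s mod 3 = k div 2" "even (l + s div 3 + k)"
  shows "six_coloring s l = k"
proof -
  have "(l + s div 3) mod 2 = k mod 2" using assms(2) by presburger
  then show ?thesis unfolding six_coloring_def assms(1) by simp
qed

text \<open>The level modulo 3 decides whether \<open>k\<close> is possible, and the parity of rank
  plus phase decides the rest. Two edges of one direction on such levels with different parities
  receive both colors available there, so one of them has color \<open>k\<close>, whatever
  \<open>B\<close> contributes to the rank.\<close>

lemma six_coloring_twice:
  assumes "finite B" "B \<inter> D = {}" "card D = 4" "finite D" "k < 6"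
  obtains T a T' a' where "a \<noteq> a'" "T \<subseteq> D" "a \<in> D - T" "T' \<subseteq> D" "a' \<in> D - T'"
    "six_coloring (card (B \<union> T)) (rank a (B \<union> T)) = k"
    "six_coloring (card (B \<union> T')) (rank a' (B \<union> T')) = k"
proof -
  have "D \<in> nsets D 4" using assms by (simp add: nsets_def)
  then obtain a\<^sub>0 a\<^sub>1 a\<^sub>2 a\<^sub>3 where D: "D = {a\<^sub>0, a\<^sub>1, a\<^sub>2, a\<^sub>3}" and less: "a\<^sub>0 < a\<^sub>1" "a\<^sub>1 < a\<^sub>2" "a\<^sub>2 < a\<^sub>3"
    by (auto simp: ordered_nsets_4_eq)
  define hits where "hits a \<longleftrightarrow>
    (\<exists>T. T \<subseteq> D \<and> a \<in> D - T \<and> six_coloring (card (B \<union> T)) (rank a (B \<union> T)) = k)" for a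
  define s where "s = card B"
  have hits: "hits a" if T: "T \<subseteq> D" "a \<in> D - T" "(s + card T) mod 3 = k div 2"
    and ev: "even (rank a B + rank a T + (s + card T) div 3 + k)" for T a
  proof -
    have "finite T" "B \<inter> T = {}" using T(1) assms finite_subset by blast+
    then have "card (B \<union> T) = s + card T" "rank a (B \<union> T) = rank a B + rank a T"
      using assms(1) by (simp_all add: card_Un_disjoint rank_Un_disjoint s_def)
    then show ?thesis unfolding hits_def using T six_coloring_eqI ev by metis
  qed
  have hits_either: "hits a"
    if "T \<subseteq> D" "a \<in> D - T" "(s + card T) mod 3 = k div 2"
      "T' \<subseteq> D" "a \<in> D - T'" "(s + card T') mod 3 = k div 2"
      "odd (rank a T + (s + card T) div 3 + (rank a T' + (s + card T') div 3))" for T T' a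
  proof (cases "even (rank a B + rank a T + (s + card T) div 3 + k)")
    case True
    then show ?thesis using hits[OF that(1-3)] by simp
  next
    case False
    then have "even (rank a B + rank a T' + (s + card T') div 3 + k)" using that(7) by auto
    then show ?thesis using hits[OF that(4-6)] by simp
  qed
  have less': "a\<^sub>0 < a\<^sub>2" "a\<^sub>0 < a\<^sub>3" "a\<^sub>1 < a\<^sub>3" using less by linarith+
  note ord = less less' less[THEN less_imp_neq] less'[THEN less_imp_neq]
    less[THEN less_imp_neq, symmetric] less'[THEN less_imp_neq, symmetric]
    less[THEN less_not_sym] less'[THEN less_not_sym]
  have "k div 2 < 3" using assms(5) by simp
  \<comment> \<open>Modulo 3, \<open>2 * s\<close> is \<open>- s\<close>; so \<open>s + j\<close> is
    the first level from \<open>s\<close> on that can carry \<open>k\<close>.\<close>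
  define j where "j = (k div 2 + 2 * s) mod 3"
  have "(s + j) mod 3 = (k div 2 + 3 * s) mod 3"
    unfolding j_def mod_add_right_eq by (simp add: algebra_simps)
  with \<open>k div 2 < 3\<close> have j: "j < 3" "(s + j) mod 3 = k div 2"
    by (simp_all add: j_def)
  from j(1) consider "j = 0" | "j = 1" | "j = 2" by linarith
  then consider "s mod 3 = k div 2" | "(s + 1) mod 3 = k div 2" | "(s + 2) mod 3 = k div 2"
    by cases (use j in simp_all)
  then have "\<exists>a a'. a \<noteq> a' \<and> hits a \<and> hits a'"
  proof cases
    case 1
    \<comment> \<open>Levels \<open>s\<close> and \<open>s + 3\<close> both carry \<open>k\<close>,
      with opposite phases. The ranks must then agree in parity, so the direction needs an even
      number of predecessors in \<open>D\<close>: 0 or 2.\<close>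
    have "hits a\<^sub>0"
      by (rule hits_either[of "{}" _ "{a\<^sub>1, a\<^sub>2, a\<^sub>3}"]) (use 1 in \<open>simp_all add: D rank_insert ord\<close>)
    moreover have "hits a\<^sub>2"
      by (rule hits_either[of "{}" _ "{a\<^sub>0, a\<^sub>1, a\<^sub>3}"]) (use 1 in \<open>simp_all add: D rank_insert ord\<close>)
    ultimately show ?thesis using ord by metis
  next
    case 2
    \<comment> \<open>Here and in the next case both sets have the same size, hence the same phase.
      Exchanging an element above the direction for one below raises the rank by 1; the middle
      directions have both.\<close>
    have "hits a\<^sub>1"
      by (rule hits_either[of "{a\<^sub>2}" _ "{a\<^sub>0}"]) (use 2 in \<open>simp_all add: D rank_insert ord\<close>)
    moreover have "hits a\<^sub>2"
      by (rule hits_either[of "{a\<^sub>3}" _ "{a\<^sub>0}"]) (use 2 in \<open>simp_all add: D rank_insert ord\<close>)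
    ultimately show ?thesis using ord by metis
  next
    case 3
    have "hits a\<^sub>1"
      by (rule hits_either[of "{a\<^sub>2, a\<^sub>3}" _ "{a\<^sub>0, a\<^sub>2}"]) (use 3 in \<open>simp_all add: D rank_insert ord\<close>)
    moreover have "hits a\<^sub>2"
      by (rule hits_either[of "{a\<^sub>0, a\<^sub>3}" _ "{a\<^sub>0, a\<^sub>1}"]) (use 3 in \<open>simp_all add: D rank_insert ord\<close>)
    ultimately show ?thesis using ord by metis
  qed
  then show ?thesis using that unfolding hits_def by metis
qed

lemma polychromatic_six_coloring:
  assumes "e \<in> edges (hypercube 4)"
  shows "polychromatic_coloring (delete_edge (hypercube 4) e) 6 n (simple_coloring six_coloring)"
  unfolding polychromatic_coloring_def
proof (intro conjI ballI allI impI)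
  fix w assume "w \<in> edges (hypercube n)"
  show "simple_coloring six_coloring w < 6"
    by (simp add: simple_coloring_def Let_def six_coloring_less)
next
  fix H k assume H: "embedding (delete_edge (hypercube 4) e) n H" and k: "k < (6::nat)"
  obtain B D a\<^sub>0 where BD: "B \<subseteq> {..<n}" "D \<subseteq> {..<n}" "card D = 4" "B \<inter> D = {}"
    and edge: "\<And>T a. T \<subseteq> D \<Longrightarrow> a \<in> D - T \<Longrightarrow> a \<noteq> a\<^sub>0 \<Longrightarrow>
      {bits n (B \<union> T), bits n (B \<union> insert a T)} \<in> edges H"
    using embedding_punctured_cubeE[OF H assms] by metis
  have fin: "finite B" "finite D" using BD finite_subset by blast+
  obtain T a T' a' where T: "a \<noteq> a'" "T \<subseteq> D" "a \<in> D - T" "T' \<subseteq> D" "a' \<in> D - T'"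
    "six_coloring (card (B \<union> T)) (rank a (B \<union> T)) = k"
    "six_coloring (card (B \<union> T')) (rank a' (B \<union> T')) = k"
    using six_coloring_twice[OF fin(1) BD(4,3) fin(2) k] by metis
  have color: "simple_coloring six_coloring {bits n (B \<union> W), bits n (B \<union> insert b W)}
      = six_coloring (card (B \<union> W)) (rank b (B \<union> W))" if "W \<subseteq> D" "b \<in> D - W" for W b
  proof -
    have "B \<union> W \<subseteq> {..<n}" "b < n" "b \<notin> B \<union> W" using BD that by auto
    then show ?thesis using simple_coloring_edge[of "B \<union> W" n b] by simp
  qed
  show "\<exists>w\<in>edges H. simple_coloring six_coloring w = k"
  proof (cases "a = a\<^sub>0")
    case False
    then show ?thesis using edge[OF T(2,3)] color[OF T(2,3)] T(6) by metis
  next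
    case True
    then show ?thesis using edge[OF T(4,5)] color[OF T(4,5)] T(1,7) by metis
  qed
qed

subsection \<open>Reduction to simple colorings\<close>

text \<open>Ramsey's theorem moved from an initial segment to any large finite \<open>V\<close>, so
  that a homogeneous set can be the ground set of a further application.\<close>

lemma ramsey_subset:
  fixes r m u :: nat
  shows "\<exists>N. \<forall>V::nat set. \<forall>F. finite V \<longrightarrow> N \<le> card V \<longrightarrow> (\<forall>Y. F Y < r) \<longrightarrow>
    (\<exists>H\<subseteq>V. card H = m \<and> (\<exists>t. \<forall>Y\<subseteq>H. card Y = u \<longrightarrow> F Y = t))"
proof -
  obtain N :: nat where N: "partn_lst {..<N} (replicate r m) u"
    using ramsey_full by blast
  have "\<exists>H\<subseteq>V. card H = m \<and> (\<exists>t. \<forall>Y\<subseteq>H. card Y = u \<longrightarrow> F Y = t)"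
    if V: "finite V" "N \<le> card V" and F: "\<forall>Y. F Y < r" for V :: "nat set" and F
  proof -
    obtain h :: "nat \<Rightarrow> nat" where h: "bij_betw h {..<card V} V"
      using ex_bij_betw_nat_finite[OF V(1)] by (metis atLeast0LessThan)
    have "(\<lambda>Y. F (h ` Y)) \<in> nsets {..<N} u \<rightarrow> {..<r}" using F by auto
    from partn_lstE[OF N this] obtain t H where t: "t < r" "H \<in> nsets {..<N} (replicate r m ! t)"
      and mono: "(\<lambda>Y. F (h ` Y)) ` nsets H u \<subseteq> {t}"
      by auto
    have H: "H \<subseteq> {..<N}" "finite H" "card H = m" using t by (auto simp: nsets_def)
    have HV: "H \<subseteq> {..<card V}" using H V by auto
    have inj: "inj_on h H" using h HV by (auto simp: bij_betw_def intro: inj_on_subset)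
    have "F Y = t" if Y: "Y \<subseteq> h ` H" "card Y = u" for Y
    proof -
      have "Y \<in> nsets (h ` H) u" using Y H finite_subset[OF Y(1)] by (simp add: nsets_def)
      then obtain Z where "Z \<in> nsets H u" "Y = h ` Z" using nset_image_obtains inj by metis
      then show ?thesis using mono by auto
    qed
    moreover have "h ` H \<subseteq> V" using h HV by (auto simp: bij_betw_def)
    moreover have "card (h ` H) = m" using inj H by (simp add: card_image)
    ultimately show ?thesis by blast
  qed
  then show ?thesis by blast
qed

text \<open>Induction on \<open>J\<close>: a set homogeneous for the new index is taken so large
  that the induction hypothesis applies inside it, and homogeneity passes to subsets.\<close>

lemma ramsey_family:
  fixes u :: "'j \<Rightarrow> nat" and r m :: nat
  assumes "finite J"
  shows "\<exists>N. \<forall>V::nat set. \<forall>F. finite V \<longrightarrow> N \<le> card V \<longrightarrow> (\<forall>j Y. F j Y < r) \<longrightarrow>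
    (\<exists>H\<subseteq>V. card H = m \<and> (\<forall>j\<in>J. \<exists>t. \<forall>Y\<subseteq>H. card Y = u j \<longrightarrow> F j Y = t))"
  using assms
proof (induction J)
  case empty
  have "\<exists>H\<subseteq>V. card H = m" if "m \<le> card V" for V :: "nat set"
    using obtain_subset_with_card_n[OF that] by metis
  then show ?case by (intro exI[of _ m]) simp
next
  case (insert j J)
  from insert.IH obtain N where N: "\<forall>V::nat set. \<forall>F. finite V \<longrightarrow> N \<le> card V \<longrightarrow> (\<forall>j Y. F j Y < r) \<longrightarrow>
    (\<exists>H\<subseteq>V. card H = m \<and> (\<forall>j\<in>J. \<exists>t. \<forall>Y\<subseteq>H. card Y = u j \<longrightarrow> F j Y = t))" ..
  from ramsey_subset obtain K where K: "\<forall>V::nat set. \<forall>F. finite V \<longrightarrow> K \<le> card V \<longrightarrow> (\<forall>Y. F Y < r) \<longrightarrow>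
    (\<exists>H\<subseteq>V. card H = N \<and> (\<exists>t. \<forall>Y\<subseteq>H. card Y = u j \<longrightarrow> F Y = t))" ..
  have "\<exists>H\<subseteq>V. card H = m \<and> (\<forall>i\<in>insert j J. \<exists>t. \<forall>Y\<subseteq>H. card Y = u i \<longrightarrow> F i Y = t)"
    if V: "finite V" "K \<le> card V" and F: "\<forall>i Y. F i Y < r" for V :: "nat set" and F
  proof -
    obtain W t where W: "W \<subseteq> V" "card W = N" "\<forall>Y\<subseteq>W. card Y = u j \<longrightarrow> F j Y = t"
      using K[rule_format, OF V, of "F j"] F by blast
    have "finite W" using W V finite_subset by blast
    then obtain H where "H \<subseteq> W" "card H = m" "\<forall>j\<in>J. \<exists>t. \<forall>Y\<subseteq>H. card Y = u j \<longrightarrow> F j Y = t"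
      using N[rule_format, of W F] W F by auto
    moreover have "\<exists>t. \<forall>Y\<subseteq>H. card Y = u j \<longrightarrow> F j Y = t"
      using W(3) \<open>H \<subseteq> W\<close> by (intro exI[of _ t]) (meson order_trans)
    ultimately show ?thesis using W(1) by (metis insert_iff order_trans)
  qed
  then show ?case by (intro exI[of _ K]) simp
qed

text \<open>An edge is determined by its upper endpoint \<open>Y\<close> and the rank in
  \<open>Y\<close> of the added element. So each pair of a size and a rank gives a coloring of the
  sets of that size. On a set homogeneous for all pairs, the increasing enumeration \<open>h\<close>
  preserves sizes and ranks.\<close>

lemma simple_subcube:
  obtains N where "\<And>\<chi> :: nat set \<Rightarrow> nat \<Rightarrow> nat. (\<And>X a. \<chi> X a < r) \<Longrightarrow>
    \<exists>h g. strict_mono_on {..<m} h \<and> h ` {..<m} \<subseteq> {..<N} \<and>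
      (\<forall>X a. X \<subseteq> {..<m} \<longrightarrow> a < m \<longrightarrow> a \<notin> X \<longrightarrow> \<chi> (h ` X) (h a) = g (card X) (rank a X))"
proof -
  define J where "J = {..m} \<times> {..m}"
  have "finite J" by (simp add: J_def)
  from ramsey_family[OF this, of r m fst]
  obtain N where N: "\<forall>V::nat set. \<forall>F. finite V \<longrightarrow> N \<le> card V \<longrightarrow> (\<forall>j Y. F j Y < r) \<longrightarrow>
    (\<exists>H\<subseteq>V. card H = m \<and> (\<forall>j\<in>J. \<exists>t. \<forall>Y\<subseteq>H. card Y = fst j \<longrightarrow> F j Y = t))" ..
  have "\<exists>h g. strict_mono_on {..<m} h \<and> h ` {..<m} \<subseteq> {..<N} \<and>
      (\<forall>X a. X \<subseteq> {..<m} \<longrightarrow> a < m \<longrightarrow> a \<notin> X \<longrightarrow> \<chi> (h ` X) (h a) = g (card X) (rank a X))"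
    if \<chi>: "\<And>X a. \<chi> X a < r" for \<chi> :: "nat set \<Rightarrow> nat \<Rightarrow> nat"
  proof -
    \<comment> \<open>The element of \<open>Y\<close> of rank \<open>i\<close>, unique by
      \<open>rank_inj\<close>. If there is none the value is arbitrary, which is why
      \<open>\<chi>\<close> is bounded on all arguments.\<close>
    define el where "el i Y = (THE a. a \<in> Y \<and> rank a Y = i)" for i Y
    define F where "F j Y = \<chi> (Y - {el (snd j) Y}) (el (snd j) Y)" for j :: "nat \<times> nat" and Y
    have "\<forall>j Y. F j Y < r" using \<chi> by (simp add: F_def)
    then obtain H where H: "H \<subseteq> {..<N}" "card H = m"
      and "\<forall>j\<in>J. \<exists>t. \<forall>Y\<subseteq>H. card Y = fst j \<longrightarrow> F j Y = t"
      using N[rule_format, of "{..<N}" F] by auto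
    then obtain t where t: "\<And>j Y. j \<in> J \<Longrightarrow> Y \<subseteq> H \<Longrightarrow> card Y = fst j \<Longrightarrow> F j Y = t j"
      by metis
    have fin: "finite H" using H finite_subset by blast
    define h where "h i = sorted_list_of_set H ! i" for i
    have h: "strict_mono_on {..<m} h"
      using sorted_wrt_nth_less[OF strict_sorted_list_of_set[of H]] H
      by (auto simp: strict_mono_on_def h_def)
    have hH: "h ` {..<m} \<subseteq> H"
    proof
      fix y assume "y \<in> h ` {..<m}"
      then obtain i where "i < m" "y = sorted_list_of_set H ! i" by (auto simp: h_def)
      then have "y \<in> set (sorted_list_of_set H)" using H by simp
      then show "y \<in> H" using fin by simp
    qed
    have "\<chi> (h ` X) (h a) = t (Suc (card X), rank a X)" if X: "X \<subseteq> {..<m}" "a < m" "a \<notin> X" for X a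
    proof -
      let ?Y = "h ` insert a X"
      have finX: "finite X" using X finite_subset by blast
      have inj: "inj_on h {..<m}" using h by (rule strict_mono_on_imp_inj_on)
      have aX: "insert a X \<subseteq> {..<m}" using X by auto
      have "card X < card (insert a X)" using X finX by simp
      also have "\<dots> \<le> m" using card_mono[OF _ aX] by simp
      finally have "card X < m" .
      moreover have "rank a X \<le> card X" unfolding rank_def using finX by (intro card_mono) auto
      ultimately have "(Suc (card X), rank a X) \<in> J" by (auto simp: J_def)
      moreover have "?Y \<subseteq> H" using aX hH by auto
      moreover have "card ?Y = Suc (card X)"
        using inj_on_subset[OF inj aX] finX X by (simp add: card_image)
      ultimately have "F (Suc (card X), rank a X) ?Y = t (Suc (card X), rank a X)"
        using t[of "(Suc (card X), rank a X)" ?Y] by simp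
      moreover have "el (rank a X) ?Y = h a"
      proof -
        have "rank (h a) ?Y = rank a X"
          using rank_image[OF h aX] X finX by (simp add: rank_insert)
        then have ha: "h a \<in> ?Y \<and> rank (h a) ?Y = rank a X" by blast
        have "finite ?Y" using finX by blast
        with ha have "b = h a" if "b \<in> ?Y \<and> rank b ?Y = rank a X" for b
          using that rank_inj[of ?Y b "h a"] by argo
        with ha show ?thesis unfolding el_def by (rule the_equality)
      qed
      moreover have "?Y - {h a} = h ` X"
      proof -
        have "h a \<notin> h ` X" using inj_on_image_mem_iff[OF inj, of a X] X by simp
        then show ?thesis by auto
      qed
      ultimately show ?thesis by (simp add: F_def)
    qed
    \<comment> \<open>The pairs in \<open>J\<close> record the size of the upper endpoint, while
      \<open>g\<close> takes that of the lower one; hence \<open>Suc s\<close>.\<close>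
    then show ?thesis using h hH H by (intro exI[of _ h] exI[of _ "\<lambda>s l. t (Suc s, l)"]) auto
  qed
  then show ?thesis using that by blast
qed

subsection \<open>Counting colors on shape sequences\<close>

text \<open>Each stage settles one more color: the current interval is cut into quarters, in one of
  which, the \<open>i\<close>-th, \<open>P q i\<close> holds throughout, and that quarter is kept.
  After \<open>r\<close> stages length \<open>L\<close> remains.\<close>

lemma nested_intervals:
  fixes P :: "nat \<Rightarrow> nat \<Rightarrow> nat \<Rightarrow> bool"
  assumes P: "\<And>k x. k < r \<Longrightarrow> (\<And>i j. i \<le> j \<Longrightarrow> j < 4 \<Longrightarrow> x i \<le> x j) \<Longrightarrow>
      (\<And>i. i < 4 \<Longrightarrow> x i < 4 ^ r * L) \<Longrightarrow> \<exists>i<4. P k i (x i)"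
    and "q \<le> r"
  shows "\<exists>a. a + 4 ^ (r - q) * L \<le> 4 ^ r * L \<and>
    (\<forall>k<q. \<exists>i<4. \<forall>y\<in>{a..<a + 4 ^ (r - q) * L}. P k i y)"
  using \<open>q \<le> r\<close>
proof (induction q)
  case 0
  then show ?case by auto
next
  case (Suc q)
  define w where "w = 4 ^ (r - Suc q) * L"
  have "r - q = Suc (r - Suc q)" using Suc.prems by simp
  then have w: "4 ^ (r - q) * L = 4 * w" by (simp add: w_def)
  obtain a where a: "a + 4 * w \<le> 4 ^ r * L"
    "\<And>k. k < q \<Longrightarrow> \<exists>i<4. \<forall>y\<in>{a..<a + 4 * w}. P k i y"
    using Suc unfolding w by auto
  \<comment> \<open>Otherwise bad points \<open>x i\<close> in the consecutive quarters form an increasing sequence avoiding \<open>q\<close>.\<close>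
  have "\<exists>i<4. \<forall>y\<in>{a + i * w..<a + i * w + w}. P q i y"
  proof (rule ccontr)
    assume "\<not> ?thesis"
    then have "\<forall>i. \<exists>y. i < 4 \<longrightarrow> y \<in> {a + i * w..<a + i * w + w} \<and> \<not> P q i y" by blast
    then obtain x where x: "\<And>i. i < 4 \<Longrightarrow> x i \<in> {a + i * w..<a + i * w + w} \<and> \<not> P q i (x i)"
      by metis
    have up: "x i < a + Suc i * w" "a + i * w \<le> x i" if "i < 4" for i using x[OF that] by auto
    have "x i \<le> x j" if "i \<le> j" "j < 4" for i j
    proof (cases "i = j")
      case False
      then have "Suc i * w \<le> j * w" using that by (intro mult_le_mono1) simp
      then show ?thesis using up(1)[of i] up(2)[of j] that by linarith
    qed simp
    moreover have "x i < 4 ^ r * L" if "i < 4" for i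
    proof -
      have "Suc i * w \<le> 4 * w" using that by (intro mult_le_mono1) simp
      then show ?thesis using up(1)[OF that] a(1) by linarith
    qed
    ultimately obtain i where "i < 4" "P q i (x i)" using P[of q x] Suc.prems by auto
    then show False using x by blast
  qed
  then obtain i where i: "i < 4" "\<And>y. y \<in> {a + i * w..<a + i * w + w} \<Longrightarrow> P q i y" by blast
  have "Suc i * w \<le> 4 * w" using i(1) by (intro mult_le_mono1) simp
  then have le: "a + i * w + w \<le> a + 4 * w" by simp
  then have bound: "a + i * w + w \<le> 4 ^ r * L" using a(1) by (rule order_trans)
  from le have sub: "{a + i * w..<a + i * w + w} \<subseteq> {a..<a + 4 * w}" by auto
  have "\<exists>i'<4. \<forall>y\<in>{a + i * w..<a + i * w + w}. P k i' y" if "k < Suc q" for k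
  proof (cases "k = q")
    case True
    then show ?thesis using i by blast
  next
    case False
    then obtain i' where "i' < 4" "\<forall>y\<in>{a..<a + 4 * w}. P k i' y" using a(2)[of k] \<open>k < Suc q\<close> by auto
    then show ?thesis using sub by blast
  qed
  then show ?case unfolding w_def[symmetric] using bound by (intro exI[of _ "a + i * w"]) blast
qed

text \<open>On the levels \<open>S, S + 1, S + 2, S + 3\<close> each of the four rectangles has at most
  \<open>1, 2, 2, 1\<close> cells. Hence a color met by all translates of one rectangle along an interval uses
  at least \<open>1/6\<close> of the cells of these levels, counted with weights \<open>1, 2, 2, 1\<close>.\<close>

lemma persistent_colors_le:
  fixes g :: "nat \<Rightarrow> nat \<Rightarrow> nat"
  assumes "\<And>k. k < r \<Longrightarrow> \<exists>i<4. \<forall>y\<in>{a..<a + L}. \<exists>p\<le>i. \<exists>q\<le>3 - i. g (S + p + q) (y + p) = k"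
  shows "r * L \<le> 6 * (L + 3)"
proof -
  have "\<forall>k. \<exists>i. k < r \<longrightarrow> i < 4 \<and> (\<forall>y\<in>{a..<a + L}. \<exists>p\<le>i. \<exists>q\<le>3 - i. g (S + p + q) (y + p) = k)"
    using assms by blast
  then obtain i where i: "\<And>k. k < r \<Longrightarrow> i k < (4::nat)"
    and "\<And>k. k < r \<Longrightarrow> \<forall>y\<in>{a..<a + L}. \<exists>p\<le>i k. \<exists>q\<le>3 - i k. g (S + p + q) (y + p) = k"
    by metis
  then have "\<forall>k y. \<exists>p q. k < r \<longrightarrow> y \<in> {a..<a + L} \<longrightarrow>
      p \<le> i k \<and> q \<le> 3 - i k \<and> g (S + p + q) (y + p) = k"
    by blast
  then obtain p q where pq: "\<And>k y. k < r \<Longrightarrow> y \<in> {a..<a + L} \<Longrightarrow>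
      p k y \<le> i k \<and> q k y \<le> 3 - i k \<and> g (S + p k y + q k y) (y + p k y) = k"
    by metis
  \<comment> \<open>For fixed \<open>i\<close> and \<open>p + q\<close>, the least possible \<open>p\<close> is the truncated difference \<open>p + q - (3 - i)\<close>.\<close>
  define code where "code = (\<lambda>(k, y). ((p k y + q k y, p k y - (p k y + q k y - (3 - i k))), y + p k y))"
  \<comment> \<open>The pairs of level and offset number \<open>1, 2, 2, 1\<close> by level. As
    \<open>p \<le> 3\<close>, the columns \<open>y + p\<close> reach up to 3 beyond the
    interval.\<close>
  define Z :: "((nat \<times> nat) \<times> nat) set" where "Z = {(0, 0), (1, 0), (1, 1), (2, 0), (2, 1), (3, 0)} \<times> {a..<a + L + 3}"
  have "inj_on code ({..<r} \<times> {a..<a + L})"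
  proof (rule inj_onI)
    fix u u' assume u: "u \<in> {..<r} \<times> {a..<a + L}" "u' \<in> {..<r} \<times> {a..<a + L}" "code u = code u'"
    obtain k y k' y' where eqs: "u = (k, y)" "u' = (k', y')" by (metis surj_pair)
    have k: "k \<in> {..<r}" "k' \<in> {..<r}" and y: "y \<in> {a..<a + L}" "y' \<in> {a..<a + L}"
      and eq: "code (k, y) = code (k', y')" using u unfolding eqs by auto
    note pq1 = pq[of k y] and pq2 = pq[of k' y']
    have sum: "p k y + q k y = p k' y' + q k' y'" and l: "y + p k y = y' + p k' y'"
      and c: "p k y - (p k y + q k y - (3 - i k)) = p k' y' - (p k' y' + q k' y' - (3 - i k'))"
      using eq by (auto simp: code_def)
    have "S + p k y + q k y = S + p k' y' + q k' y'" using sum by simp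
    \<comment> \<open>Equal level and column mean the same cell, whose color is \<open>k\<close>;
      then \<open>i k\<close> is known and the offset gives back \<open>p\<close>.\<close>
    then have kk: "k = k'" using pq1 pq2 k y l by (metis lessThan_iff)
    have "p k y = p k' y'"
      using c sum pq1 pq2 k y unfolding kk by auto
    then show "u = u'" using kk l eqs by simp
  qed
  moreover have "code ` ({..<r} \<times> {a..<a + L}) \<subseteq> Z"
  proof (rule image_subsetI)
    fix u assume "u \<in> {..<r} \<times> {a..<a + L}"
    then obtain k y where u: "u = (k, y)" and k: "k \<in> {..<r}" and y: "y \<in> {a..<a + L}"
      by blast
    have b: "p k y \<le> i k" "q k y \<le> 3 - i k" "i k < 4" using pq[of k y] i[of k] k y by auto
    define P Q I where "P = p k y" and "Q = q k y" and "I = i k"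
    have "I = 0 \<or> I = 1 \<or> I = 2 \<or> I = 3" using b(3) I_def by linarith
    moreover have "P = 0 \<or> P = 1 \<or> P = 2 \<or> P = 3" using b P_def by linarith
    moreover have "Q = 0 \<or> Q = 1 \<or> Q = 2 \<or> Q = 3" using b Q_def by linarith
    moreover have "P \<le> I" "Q \<le> 3 - I" using b by (simp_all add: P_def Q_def I_def)
    ultimately have "(P + Q, P - (P + Q - (3 - I))) \<in> {(0, 0), (1, 0), (1, 1), (2, 0), (2, 1), (3, 0)}"
      by (elim disjE) simp_all
    moreover have "y + p k y \<in> {a..<a + L + 3}" using y b by auto
    ultimately show "code u \<in> Z" by (simp add: u code_def Z_def P_def Q_def I_def)
  qed
  moreover have "finite Z" by (simp add: Z_def)
  ultimately have "card ({..<r} \<times> {a..<a + L}) \<le> card Z" by (rule card_inj_on_le)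
  then show ?thesis by (simp add: Z_def card_cartesian_product)
qed

text \<open>Here \<open>19\<close> is the least \<open>L\<close> with \<open>7 * L > 6 * (L + 3)\<close>.\<close>

lemma shape_sequence_colors_le:
  fixes g :: "nat \<Rightarrow> nat \<Rightarrow> nat"
  assumes "\<And>k x. k < r \<Longrightarrow> (\<And>i j. i \<le> j \<Longrightarrow> j < 4 \<Longrightarrow> x i \<le> x j) \<Longrightarrow>
      (\<And>i. i < 4 \<Longrightarrow> x i < 4 ^ r * 19) \<Longrightarrow>
      \<exists>i<4. \<exists>p\<le>i. \<exists>q\<le>3 - i. g (S + p + q) (x i + p) = k"
  shows "r \<le> 6"
proof -
  obtain a where "\<forall>k<r. \<exists>i<4. \<forall>y\<in>{a..<a + 19}. \<exists>p\<le>i. \<exists>q\<le>3 - i. g (S + p + q) (y + p) = k"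
    using nested_intervals[of r 19 "\<lambda>k i y. \<exists>p\<le>i. \<exists>q\<le>3 - i. g (S + p + q) (y + p) = k" r] assms
    by auto
  then have "r * 19 \<le> 6 * (19 + 3)" by (intro persistent_colors_le[of r a 19 g S]) blast
  then show ?thesis by simp
qed

section \<open>The upper bound for arbitrary colorings\<close>

lemma polychromatic_colors_le:
  assumes e: "e \<in> edges (hypercube 4)"
    and col: "\<And>n. n \<ge> 1 \<Longrightarrow> \<exists>H. embedding (delete_edge (hypercube 4) e) n H \<Longrightarrow>
      \<exists>c. polychromatic_coloring (delete_edge (hypercube 4) e) r n c"
  shows "r \<le> 6"
proof (cases "r = 0")
  case False
  \<comment> \<open>\<open>S\<close> exceeds every value \<open>x i\<close> of an admissible
    sequence; the four further elements of \<open>{..<m}\<close> leave room for the directions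
    \<open>D\<close>.\<close>
  define S :: nat where "S = 4 ^ r * 19"
  define m where "m = S + 4"
  obtain N where N: "\<And>\<chi> :: nat set \<Rightarrow> nat \<Rightarrow> nat. (\<And>X a. \<chi> X a < r) \<Longrightarrow>
    \<exists>h g. strict_mono_on {..<m} h \<and> h ` {..<m} \<subseteq> {..<N} \<and>
      (\<forall>X a. X \<subseteq> {..<m} \<longrightarrow> a < m \<longrightarrow> a \<notin> X \<longrightarrow> \<chi> (h ` X) (h a) = g (card X) (rank a X))"
    using simple_subcube[of r m] by blast
  \<comment> \<open>A coloring is promised only where an embedding exists. Applying \<open>N\<close>
    to a constant coloring gives an injection of \<open>{..<m}\<close> into
    \<open>{..<N}\<close>.\<close>
  have "4 \<le> N"
  proof -
    obtain h :: "nat \<Rightarrow> nat" where h: "strict_mono_on {..<m} h" "h ` {..<m} \<subseteq> {..<N}"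
      using N[of "\<lambda>_ _. 0"] False by auto
    have "card {..<m} \<le> card {..<N}"
      using strict_mono_on_imp_inj_on[OF h(1)] h(2) by (intro card_inj_on_le) auto
    then show ?thesis by (simp add: m_def)
  qed
  have "\<exists>H. embedding (delete_edge (hypercube 4) e) N H"
    using embedding_punctured_cubeI[OF e, of "{}" N "{..<4}"] \<open>4 \<le> N\<close> by auto
  then obtain c where c: "polychromatic_coloring (delete_edge (hypercube 4) e) r N c"
    using col[of N] \<open>4 \<le> N\<close> by auto
  \<comment> \<open>Reduction modulo \<open>r\<close> bounds the values off the edges too; a color
    \<open>k < r\<close> is unaffected.\<close>
  define \<chi> where "\<chi> X a = c {bits N X, bits N (insert a X)} mod r" for X a
  have "\<chi> X a < r" for X a using False by (simp add: \<chi>_def)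
  then obtain h g where h: "strict_mono_on {..<m} h" "h ` {..<m} \<subseteq> {..<N}"
    and g: "\<And>X a. X \<subseteq> {..<m} \<Longrightarrow> a < m \<Longrightarrow> a \<notin> X \<Longrightarrow> \<chi> (h ` X) (h a) = g (card X) (rank a X)"
    using N[of \<chi>] by blast
  have inj: "inj_on h {..<m}" using h(1) by (rule strict_mono_on_imp_inj_on)
  have "\<exists>i<4. \<exists>p\<le>i. \<exists>q\<le>3 - i. g (S + p + q) (x i + p) = k"
    if k: "k < r" and mono: "\<And>i j. i \<le> j \<Longrightarrow> j < 4 \<Longrightarrow> x i \<le> x j"
      and x: "\<And>i. i < 4 \<Longrightarrow> x i < 4 ^ r * 19" for k and x :: "nat \<Rightarrow> nat"
  proof -
    \<comment> \<open>With \<open>B \<union> D = {..<m}\<close>, the element \<open>f i\<close> has \<open>i\<close> predecessors in \<open>D\<close> and hence \<open>x i\<close> in \<open>B\<close>.\<close>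
    define f where "f i = x i + i" for i
    \<comment> \<open>Adding \<open>i\<close> turns the weakly increasing \<open>x\<close> into a
      strictly increasing sequence.\<close>
    have f_less: "f i < f j \<longleftrightarrow> i < j" if "i < 4" "j < 4" for i j
      using mono[of i j] mono[of j i] that unfolding f_def by linarith
    have inj_f: "inj_on f {..<4}"
      using f_less by (intro inj_onI) (metis lessThan_iff less_irrefl linorder_neqE_nat)
    define D where "D = f ` {..<4}"
    define B where "B = {..<m} - D"
    have "f i < m" if "i < 4" for i using x[OF that] that by (simp add: f_def m_def S_def)
    then have Dm: "D \<subseteq> {..<m}" by (auto simp: D_def)
    have Bm: "B \<subseteq> {..<m}" by (auto simp: B_def)
    have D4: "card D = 4" using inj_f by (simp add: D_def card_image)
    have finD: "finite D" by (simp add: D_def)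
    have finB: "finite B" by (simp add: B_def)
    have cardB: "card B = S" using Dm D4 finD by (simp add: B_def card_Diff_subset m_def)
    have hBD: "h ` B \<subseteq> {..<N}" "h ` D \<subseteq> {..<N}" using h(2) Bm Dm by blast+
    have hD4: "card (h ` D) = 4" using inj_on_subset[OF inj Dm] D4 by (simp add: card_image)
    have disj: "h ` B \<inter> h ` D = {}"
      using inj_on_image_Int[OF inj Bm Dm] by (auto simp: B_def)
    obtain H where H: "embedding (delete_edge (hypercube 4) e) N H"
      and sub: "edges H \<subseteq>
        {{bits N (h ` B \<union> T), bits N (h ` B \<union> insert a T)} | T a. T \<subseteq> h ` D \<and> a \<in> h ` D - T}"
      by (rule embedding_punctured_cubeI[OF e hBD hD4 disj])
    obtain w where w: "w \<in> edges H" "c w = k"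
      using c H k unfolding polychromatic_coloring_def by blast
    then obtain T' a' where T': "w = {bits N (h ` B \<union> T'), bits N (h ` B \<union> insert a' T')}"
      "T' \<subseteq> h ` D" "a' \<in> h ` D - T'"
      using sub by blast
    then obtain T where T: "T \<subseteq> D" "T' = h ` T" by (meson subset_imageE)
    obtain a where a: "a \<in> D" "a' = h a" "a \<notin> T" using T' T by auto
    obtain i where i: "i < 4" "a = f i" using a by (auto simp: D_def)
    have finT: "finite T" and BT: "B \<inter> T = {}"
      using T finD finite_subset by (auto simp: B_def)
    have "\<chi> (h ` (B \<union> T)) (h a) = k"
      using w(2) k T' T a by (simp add: \<chi>_def image_Un)
    moreover have "\<chi> (h ` (B \<union> T)) (h a) = g (card (B \<union> T)) (rank a (B \<union> T))"
      using g[of "B \<union> T" a] Bm Dm T a by (auto simp: B_def)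
    moreover have "card (B \<union> T) = S + card T"
      using finB finT BT cardB by (simp add: card_Un_disjoint)
    moreover have "rank a (B \<union> T) = x i + rank a T"
    proof -
      have "{j \<in> D. j < a} = f ` {..<i}"
        using f_less i by (auto simp: D_def)
      then have "rank a D = i"
        unfolding rank_def using inj_on_subset[OF inj_f, of "{..<i}"] i by (simp add: card_image)
      moreover have "rank a (B \<union> D) = a"
      proof -
        have "{j \<in> B \<union> D. j < a} = {..<a}" using a Dm by (auto simp: B_def)
        then show ?thesis by (simp add: rank_def)
      qed
      moreover have "rank a (B \<union> D) = rank a B + rank a D"
        using finB finD by (intro rank_Un_disjoint) (auto simp: B_def)
      ultimately have "rank a B = x i" using i by (simp add: f_def)
      then show ?thesis using rank_Un_disjoint[OF finB finT BT] by simp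
    qed
    \<comment> \<open>The witnesses \<open>p\<close> and \<open>q\<close> count the elements of
      \<open>T\<close> below and above \<open>a\<close>; \<open>D\<close> has \<open>i\<close>
      elements below \<open>f i\<close> and \<open>3 - i\<close> above it.\<close>
    moreover have "rank a T \<le> i"
    proof -
      have "{j \<in> T. j < a} \<subseteq> f ` {..<i}" using f_less i T by (auto simp: D_def)
      then have "rank a T \<le> card (f ` {..<i})" unfolding rank_def by (intro card_mono) auto
      also have "\<dots> \<le> i" using card_image_le[of "{..<i}" f] by simp
      finally show ?thesis .
    qed
    moreover have "card T - rank a T \<le> 3 - i" "rank a T \<le> card T"
    proof -
      have "T = {j \<in> T. j < a} \<union> {j \<in> T. a < j}" using a by (auto simp: not_less_iff_gr_or_eq)
      then have "card T = card ({j \<in> T. j < a} \<union> {j \<in> T. a < j})" by simp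
      also have "\<dots> = rank a T + card {j \<in> T. a < j}"
        unfolding rank_def using finT by (intro card_Un_disjoint) auto
      finally have split: "card T = rank a T + card {j \<in> T. a < j}" .
      have "{j \<in> T. a < j} \<subseteq> f ` {i<..<4}" using f_less i T by (auto simp: D_def)
      then have "card {j \<in> T. a < j} \<le> card (f ` {i<..<4})" by (intro card_mono) auto
      also have "\<dots> \<le> 3 - i" using card_image_le[of "{i<..<4}" f] by simp
      finally show "card T - rank a T \<le> 3 - i" "rank a T \<le> card T" using split by simp_all
    qed
    ultimately show ?thesis
      using i(1) by (intro exI[of _ i] conjI exI[of _ "rank a T"] exI[of _ "card T - rank a T"]) simp_all
  qed
  then show ?thesis by (rule shape_sequence_colors_le)
qed simp

theorem theorem12:
  fixes e :: "bool list set"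
  assumes "e \<in> edges (hypercube 4)"
  shows "polychromatic_number (delete_edge (hypercube 4) e) = 6"
  unfolding polychromatic_number_def
proof (rule Greatest_equality)
  show "\<forall>n\<ge>1. (\<exists>H. embedding (delete_edge (hypercube 4) e) n H) \<longrightarrow>
      (\<exists>c. polychromatic_coloring (delete_edge (hypercube 4) e) 6 n c)"
    using polychromatic_six_coloring[OF assms] by blast
next
  fix r
  assume "\<forall>n\<ge>1. (\<exists>H. embedding (delete_edge (hypercube 4) e) n H) \<longrightarrow>
      (\<exists>c. polychromatic_coloring (delete_edge (hypercube 4) e) r n c)"
  then show "r \<le> 6" by (intro polychromatic_colors_le[OF assms]) blast
qed

end
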